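(* Let $B$ be a completely simple left semi-brace such that $\rho$ is an anti-homomorphism, and let $r_G$ be the solution associated to the skew left brace $G=0+B+0$. Then, for every integer $n\ge 1$, $$r_G^n=\mathrm{id}\iff r_B^{n+1}=r_B.$$ In particular, $G$ is a left brace if and only if $r_B^3=r_B$.
   Context: A left semi-brace is a set $B$ with operations $+$ and $\circ$ such that $(B,+)$ is a semigroup, $(B,\circ)$ is a group, and $a\circ(b+c)=a\circ b+a\circ(a^-+c)$ for all $a,b,c\in B$, where $a^-$ is the inverse of $a$ in $(B,\circ)$. The identity of $(B,\circ)$ is denoted $0$. It is called completely simple if the semigroup $(B,+)$ is completely simple. For $a,b\in B$ put $\lambda_a(b)=a\circ(a^-+b)$ and $\rho_b(a)=(a^-+b)^-\circ b$, and $r_B:B\times B\to B\times B$, $r_B(a,b)=(\lambda_a(b),\rho_b(a))$. The map $\rho:b\mapsto\rho_b$ from $(B,\circ)$ to the monoid of self-maps of $B$ is an anti-homomorphism if $\rho_{a\circ b}=\rho_b\rho_a$ for all $a,b\in B$. In this case $r_B$ is a set-theoretical solution of the Yang–Baxter equation, i.e. $(r_B\times \mathrm{id})(\mathrm{id}\times r_B)(r_B\times \mathrm{id})=(\mathrm{id}\times r_B)(r_B\times \mathrm{id})(\mathrm{id}\times r_B)$ (the solution associated to $B$). Powers of $r_B$ are iterated compositions. A skew left brace is a set with operations $+,\circ$, both group structures, such that $a\circ(b+c)=a\circ b-a+a\circ c$; it is a left semi-brace. A left brace is a skew left brace whose additive group is abelian. For $B$ as in the claim, it is known that $G=0+B+0=\{0+b+0: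 b\in B\}$, with the operations of $B$, is a skew left brace; $r_G$ is defined from $G$ by the same formula as $r_B$. *)

theory Defs
  imports "HOL-Algebra.Group"
begin

text \<open>
  A structure with two operations on one carrier: the monoid part of the record is the
  multiplicative operation \<open>\<circ>\<close>, written \<open>\<otimes>\<close>, whose identity \<open>\<one>\<close> is the element called \<open>0\<close>
  on paper; the additional field is the addition \<open>+\<close>, written \<open>\<boxplus>\<close>. No neutral element of the
  addition is part of the structure, since the additive semigroup of a semi-brace need not have one.
\<close>

record 'a semi_brace = "'a monoid" +
  plus_op :: "['a, 'a] \<Rightarrow> 'a" (infixl \<open>\<boxplus>\<index>\<close> 65)


definition semigroup_on :: "'a set \<Rightarrow> ('a \<Rightarrow> 'a \<Rightarrow> 'a) \<Rightarrow> bool" where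
  "semigroup_on S f \<longleftrightarrow>
     (\<forall>x\<in>S. \<forall>y\<in>S. f x y \<in> S) \<and>
     (\<forall>x\<in>S. \<forall>y\<in>S. \<forall>z\<in>S. f (f x y) z = f x (f y z))"

definition two_sided_ideal :: "'a set \<Rightarrow> ('a \<Rightarrow> 'a \<Rightarrow> 'a) \<Rightarrow> 'a set \<Rightarrow> bool" where
  "two_sided_ideal S f I \<longleftrightarrow>
     I \<noteq> {} \<and> I \<subseteq> S \<and> (\<forall>s\<in>S. \<forall>x\<in>I. f s x \<in> I \<and> f x s \<in> I)"

definition simple_semigroup :: "'a set \<Rightarrow> ('a \<Rightarrow> 'a \<Rightarrow> 'a) \<Rightarrow> bool" where
  "simple_semigroup S f \<longleftrightarrow> semigroup_on S f \<and> (\<forall>I. two_sided_ideal S f I \<longrightarrow> I = S)"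

text \<open>
  A primitive idempotent is an idempotent that is minimal among all idempotents for the order
  \<open>x \<le> e \<longleftrightarrow> e x = x = x e\<close>. This is the notion for semigroups without zero; a simple
  semigroup (in the sense above) with a zero has only one element.
\<close>

definition primitive_idempotent :: "'a set \<Rightarrow> ('a \<Rightarrow> 'a \<Rightarrow> 'a) \<Rightarrow> 'a \<Rightarrow> bool" where
  "primitive_idempotent S f e \<longleftrightarrow>
     e \<in> S \<and> f e e = e \<and> (\<forall>x\<in>S. f x x = x \<and> f e x = x \<and> f x e = x \<longrightarrow> x = e)"

definition completely_simple_semigroup :: "'a set \<Rightarrow> ('a \<Rightarrow> 'a \<Rightarrow> 'a) \<Rightarrow> bool" where
  "completely_simple_semigroup S f \<longleftrightarrow>
     simple_semigroup S f \<and> (\<exists>e. primitive_idempotent S f e)"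


locale left_semi_brace = group B for B (structure) +
  assumes plus_semigroup: "semigroup_on (carrier B) (plus_op B)"
    and left_semi_distrib:
      "\<lbrakk>a \<in> carrier B; b \<in> carrier B; c \<in> carrier B\<rbrakk>
        \<Longrightarrow> a \<otimes> (b \<boxplus> c) = (a \<otimes> b) \<boxplus> (a \<otimes> (inv a \<boxplus> c))"

definition lam :: "('a, 'm) semi_brace_scheme \<Rightarrow> 'a \<Rightarrow> 'a \<Rightarrow> 'a" where
  "lam B a b = a \<otimes>\<^bsub>B\<^esub> (inv\<^bsub>B\<^esub> a \<boxplus>\<^bsub>B\<^esub> b)"

definition rho :: "('a, 'm) semi_brace_scheme \<Rightarrow> 'a \<Rightarrow> 'a \<Rightarrow> 'a" where
  "rho B b a = inv\<^bsub>B\<^esub> (inv\<^bsub>B\<^esub> a \<boxplus>\<^bsub>B\<^esub> b) \<otimes>\<^bsub>B\<^esub> b"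

definition rho_anti_hom :: "('a, 'm) semi_brace_scheme \<Rightarrow> bool" where
  "rho_anti_hom B \<longleftrightarrow>
     (\<forall>a\<in>carrier B. \<forall>b\<in>carrier B. \<forall>c\<in>carrier B.
        rho B (a \<otimes>\<^bsub>B\<^esub> b) c = rho B b (rho B a c))"

text \<open>
  The solution associated to a semi-brace. Only its values on \<open>carrier B \<times> carrier B\<close> are
  meaningful, so equality of such maps has to be restricted to that set.
\<close>

definition sol :: "('a, 'm) semi_brace_scheme \<Rightarrow> 'a \<times> 'a \<Rightarrow> 'a \<times> 'a" where
  "sol B = (\<lambda>(a, b). (lam B a b, rho B b a))"


text \<open>
  The additive magma equipped with a candidate neutral element. That the neutral element of the
  additive group of a skew left brace is \<open>\<one>\<close> is a consequence of the axioms, not one of them.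
\<close>

definition additive :: "('a, 'm) semi_brace_scheme \<Rightarrow> 'a \<Rightarrow> 'a monoid" where
  "additive B e = \<lparr>carrier = carrier B, mult = plus_op B, one = e\<rparr>"

definition skew_left_brace :: "('a, 'm) semi_brace_scheme \<Rightarrow> bool" where
  "skew_left_brace B \<longleftrightarrow>
     group B \<and>
     (\<exists>e. group (additive B e) \<and>
        (\<forall>a\<in>carrier B. \<forall>b\<in>carrier B. \<forall>c\<in>carrier B.
           a \<otimes>\<^bsub>B\<^esub> (b \<boxplus>\<^bsub>B\<^esub> c) =
             (a \<otimes>\<^bsub>B\<^esub> b) \<boxplus>\<^bsub>B\<^esub> inv\<^bsub>additive B e\<^esub> a \<boxplus>\<^bsub>B\<^esub> (a \<otimes>\<^bsub>B\<^esub> c)))"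

definition left_brace :: "('a, 'm) semi_brace_scheme \<Rightarrow> bool" where
  "left_brace B \<longleftrightarrow>
     skew_left_brace B \<and>
     (\<forall>a\<in>carrier B. \<forall>b\<in>carrier B. a \<boxplus>\<^bsub>B\<^esub> b = b \<boxplus>\<^bsub>B\<^esub> a)"

text \<open>The substructure \<open>0 + B + 0\<close> with the operations of \<open>B\<close>.\<close>

definition core :: "('a, 'm) semi_brace_scheme \<Rightarrow> ('a, 'm) semi_brace_scheme" where
  "core B = B\<lparr>carrier := (\<lambda>b. \<one>\<^bsub>B\<^esub> \<boxplus>\<^bsub>B\<^esub> b \<boxplus>\<^bsub>B\<^esub> \<one>\<^bsub>B\<^esub>) ` carrier B\<rparr>"

end

theory Submission
  imports Defs
begin

text \<open>
  Write \<open>0\<close> for the identity of \<open>(B, \<circ>)\<close>. The case \<open>a = 0\<close> of the distributive law says that \<open>0\<close> is a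
  middle unit: \<open>b + 0 + c = b + c\<close>. In a completely simple semigroup this makes \<open>0\<close> idempotent and
  \<open>0 + B + 0\<close> a group. The map \<open>\<rho>\<close> is an anti-homomorphism iff \<open>x + b \<circ> c = x + b \<circ> (0 + c)\<close>, and
  then \<open>r\<^sub>B\<close> takes its values in \<open>(0 + B) \<times> (B + 0)\<close>. An element of that set can be written as
  \<open>(e \<circ> h, g \<circ> k)\<close> with \<open>h, g \<in> G\<close>, \<open>e\<^sup>- + 0 = 0\<close> and \<open>0 + k = 0\<close>, and there
  \<open>r\<^sub>B (e \<circ> h, g \<circ> k) = (e \<circ> \<lambda>\<^sub>h(g), \<rho>\<^sub>g(h) \<circ> k)\<close>; so \<open>r\<^sub>B\<close> acts on its image through \<open>r\<^sub>G\<close>.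
  In \<open>G\<close>, \<open>r\<^sub>G (a, b) = (u, v)\<close> satisfies \<open>a + u = a \<circ> b = u \<circ> v = u + \<lambda>\<^sub>u(v)\<close>, so
  \<open>r\<^sub>G\<close> is injective, and it is involutive iff the addition is commutative.
\<close>

section \<open>The local group at a primitive idempotent of a simple semigroup\<close>

locale primitive_simple_semigroup =
  fixes S :: "'a set" and f :: "'a \<Rightarrow> 'a \<Rightarrow> 'a" (infixl \<open>\<cdot>\<close> 70) and e :: 'a
  assumes simple: "simple_semigroup S f"
    and primitive: "primitive_idempotent S f e"
begin

lemma closed [simp]: "x \<in> S \<Longrightarrow> y \<in> S \<Longrightarrow> x \<cdot> y \<in> S"
  using simple by (auto simp: simple_semigroup_def semigroup_on_def)

lemma assoc: "x \<in> S \<Longrightarrow> y \<in> S \<Longrightarrow> z \<in> S \<Longrightarrow> x \<cdot> y \<cdot> z = x \<cdot> (y \<cdot> z)"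
  using simple by (auto simp: simple_semigroup_def semigroup_on_def)

lemma e_closed [simp]: "e \<in> S" and e_idem: "e \<cdot> e = e"
  using primitive by (auto simp: primitive_idempotent_def)

lemma e_left: "x \<in> S \<Longrightarrow> e \<cdot> (e \<cdot> x) = e \<cdot> x"
  using assoc[of e e x] by (simp add: e_idem)

lemma e_minimal: "x \<in> S \<Longrightarrow> x \<cdot> x = x \<Longrightarrow> e \<cdot> x = x \<Longrightarrow> x \<cdot> e = x \<Longrightarrow> x = e"
  using primitive by (auto simp: primitive_idempotent_def)

lemma in_principal_ideal:
  assumes "a \<in> S" "s \<in> S"
  obtains x y where "x \<in> S" "y \<in> S" "s = x \<cdot> a \<cdot> y"
proof -
  let ?I = "{x \<cdot> a \<cdot> y |x y. x \<in> S \<and> y \<in> S}"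
  have "t \<cdot> (x \<cdot> a \<cdot> y) = (t \<cdot> x) \<cdot> a \<cdot> y" "x \<cdot> a \<cdot> y \<cdot> t = x \<cdot> a \<cdot> (y \<cdot> t)"
    if "t \<in> S" "x \<in> S" "y \<in> S" for t x y
    using that assms(1) by (simp_all add: assoc)
  then have "two_sided_ideal S f ?I"
    unfolding two_sided_ideal_def using assms(1) by (auto 0 4)
  then have "?I = S"
    using simple by (auto simp: simple_semigroup_def)
  with assms(2) that show thesis by blast
qed

text \<open>Simplicity gives \<open>e = x \<cdot> a \<cdot> y\<close> with \<open>x\<close>,
  \<open>y\<close> absorbing \<open>e\<close> on both sides. Then
  \<open>a \<cdot> y \<cdot> x\<close> and \<open>y \<cdot> x \<cdot> a\<close> are idempotents
  below \<open>e\<close>, so both equal \<open>e\<close> by primitivity.\<close>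

lemma local_inverse:
  assumes a: "a \<in> S" and ea: "e \<cdot> a = a" and ae: "a \<cdot> e = a"
  obtains b where "b \<in> S" "e \<cdot> b = b" "b \<cdot> e = b" "a \<cdot> b = e" "b \<cdot> a = e"
proof -
  obtain x0 y0 where xy0: "x0 \<in> S" "y0 \<in> S" "e = x0 \<cdot> a \<cdot> y0"
    using in_principal_ideal[OF a e_closed] .
  define x y where "x = e \<cdot> x0 \<cdot> e" and "y = e \<cdot> y0 \<cdot> e"
  have S: "x \<in> S" "y \<in> S" "a \<in> S"
    using xy0 a by (simp_all add: x_def y_def)
  have sides: "e \<cdot> x = x" "x \<cdot> e = x" "e \<cdot> y = y" "y \<cdot> e = y"
    using xy0(1,2) by (simp_all add: x_def y_def assoc e_left e_idem)
  have "x \<cdot> a \<cdot> y = e \<cdot> x0 \<cdot> (e \<cdot> a \<cdot> e) \<cdot> y0 \<cdot> e"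
    using xy0 a by (simp add: x_def y_def assoc)
  also have "\<dots> = e \<cdot> (x0 \<cdot> a \<cdot> y0) \<cdot> e"
    using xy0(1,2) a by (simp add: ea ae) (simp add: assoc)
  also have "\<dots> = e"
    by (simp add: xy0(3)[symmetric] e_idem)
  finally have xay: "x \<cdot> (a \<cdot> y) = e"
    using S by (simp add: assoc)
  \<comment> \<open>The identities with an arbitrary factor appended, so that they still rewrite
    inside right-nested products.\<close>
  have shift: "x \<cdot> (a \<cdot> (y \<cdot> t)) = e \<cdot> t" "e \<cdot> (x \<cdot> t) = x \<cdot> t"
    "e \<cdot> (a \<cdot> t) = a \<cdot> t" "e \<cdot> (y \<cdot> t) = y \<cdot> t" if "t \<in> S" for t
    using that S assoc[of x "a \<cdot> y" t] assoc[of e x t] assoc[of e a t] assoc[of e y t]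
    by (simp_all add: assoc xay sides ea)
  have "a \<cdot> (y \<cdot> x) = e"
    by (rule e_minimal) (use S in \<open>simp_all add: assoc sides shift\<close>)
  moreover have "y \<cdot> x \<cdot> a = e"
    by (rule e_minimal) (use S in \<open>simp_all add: assoc ae shift\<close>)
  ultimately show thesis
    using S sides by (intro that[of "y \<cdot> x"]) (simp_all add: assoc shift)
qed

section \<open>Middle units and their local groups\<close>

context
  fixes u
  assumes u [simp]: "u \<in> S"
    and middle: "\<And>x y. x \<in> S \<Longrightarrow> y \<in> S \<Longrightarrow> x \<cdot> (u \<cdot> y) = x \<cdot> y"
begin

text \<open>\<open>u\<close> is \<open>\<D>\<close>-related to \<open>e\<close>, and \<open>t \<mapsto> q \<cdot> t \<cdot> p\<close> maps \<open>u \<cdot> S \<cdot> u\<close> to \<open>e \<cdot> S \<cdot> e\<close>.\<close>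

lemma middle_unit_factor:
  obtains p q where "p \<in> S" "q \<in> S" "p \<cdot> e = p" "e \<cdot> q = q" "p \<cdot> q = u" "q \<cdot> p = e" "u \<cdot> u = u"
proof -
  obtain x y where xy: "x \<in> S" "y \<in> S" "u = x \<cdot> e \<cdot> y"
    using in_principal_ideal[OF e_closed u] .
  define p q where "p = x \<cdot> e" and "q = e \<cdot> y"
  have S [simp]: "p \<in> S" "q \<in> S"
    using xy by (simp_all add: p_def q_def)
  have sides: "p \<cdot> e = p" "e \<cdot> q = q"
    using xy by (simp_all add: p_def q_def assoc e_idem e_left)
  have pq: "p \<cdot> q = u"
    using xy(1,2) by (simp add: p_def q_def assoc e_left) (simp add: xy(3) assoc)
  have "e \<cdot> (q \<cdot> p) = q \<cdot> p" "q \<cdot> p \<cdot> e = q \<cdot> p"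
    using sides assoc[of e q p] by (simp_all add: assoc)
  then obtain d where d [simp]: "d \<in> S" and de: "e \<cdot> d = d" "d \<cdot> e = d"
    and inv: "q \<cdot> p \<cdot> d = e" "d \<cdot> (q \<cdot> p) = e"
    using local_inverse[of "q \<cdot> p"] by auto
  \<comment> \<open>As \<open>d\<close> inverts \<open>q \<cdot> p\<close> at \<open>e\<close>,
    \<open>w\<close> is idempotent and \<open>u \<cdot> w = u = w \<cdot> u\<close>. The middle-unit
    law then forces \<open>w = w \<cdot> w = w \<cdot> (u \<cdot> w) = u\<close>.\<close>
  define w where "w = p \<cdot> d \<cdot> q"
  have w [simp]: "w \<in> S"
    by (simp add: w_def)
  have uw: "u \<cdot> w = u"
  proof -
    have "u \<cdot> w = p \<cdot> (q \<cdot> p \<cdot> d) \<cdot> q"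
      unfolding w_def pq[symmetric] by (simp add: assoc)
    then show ?thesis
      by (simp add: inv sides pq)
  qed
  have wu: "w \<cdot> u = u"
  proof -
    have "w \<cdot> u = p \<cdot> (d \<cdot> (q \<cdot> p)) \<cdot> q"
      unfolding w_def pq[symmetric] by (simp add: assoc)
    then show ?thesis
      by (simp add: inv sides pq)
  qed
  have "w \<cdot> w = p \<cdot> (d \<cdot> (q \<cdot> p)) \<cdot> d \<cdot> q"
    unfolding w_def by (simp add: assoc)
  also have "\<dots> = w"
    by (simp add: inv sides w_def)
  finally have "w \<cdot> (u \<cdot> w) = w"
    by (simp only: middle w)
  then have "w = u"
    by (simp add: uw wu)
  with uw have uu: "u \<cdot> u = u" by simp
  \<comment> \<open>An idempotent with an inverse \<open>d\<close> at \<open>e\<close> equals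
    \<open>e\<close>.\<close>
  have "q \<cdot> p \<cdot> (q \<cdot> p) = q \<cdot> (p \<cdot> q \<cdot> p)"
    by (simp add: assoc)
  also have "\<dots> = q \<cdot> p"
    unfolding pq by (simp add: middle)
  finally have qpqp: "q \<cdot> p \<cdot> (q \<cdot> p) = q \<cdot> p" .
  have "q \<cdot> p \<cdot> (q \<cdot> p \<cdot> d) = q \<cdot> p \<cdot> (q \<cdot> p) \<cdot> d"
    by (simp add: assoc)
  then have "q \<cdot> p \<cdot> e = e"
    by (simp only: qpqp inv)
  then have "q \<cdot> p = e"
    by (simp add: assoc sides)
  then show thesis
    using that[OF S sides pq _ uu] by simp
qed

lemma middle_unit_idem: "u \<cdot> u = u"
  using middle_unit_factor .

text \<open>If \<open>n\<close> inverts \<open>q \<cdot> a \<cdot> p\<close> at \<open>e\<close>,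
  then \<open>p \<cdot> n \<cdot> q\<close> inverts \<open>a\<close> at \<open>u\<close>.\<close>

lemma middle_unit_local_inverse:
  assumes a: "a \<in> S" and ua: "u \<cdot> a = a" and au: "a \<cdot> u = a"
  obtains b where "b \<in> S" "u \<cdot> b = b" "b \<cdot> u = b" "a \<cdot> b = u" "b \<cdot> a = u"
proof -
  obtain p q where [simp]: "p \<in> S" "q \<in> S" and sides: "p \<cdot> e = p" "e \<cdot> q = q"
    and pq: "p \<cdot> q = u" and qp: "q \<cdot> p = e"
    using middle_unit_factor .
  have "e \<cdot> (q \<cdot> a \<cdot> p) = e \<cdot> q \<cdot> a \<cdot> p" "q \<cdot> a \<cdot> p \<cdot> e = q \<cdot> a \<cdot> (p \<cdot> e)"
    using a by (simp_all add: assoc)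
  then obtain n where [simp]: "n \<in> S" and ne: "e \<cdot> n = n" "n \<cdot> e = n"
    and n: "q \<cdot> a \<cdot> p \<cdot> n = e" "n \<cdot> (q \<cdot> a \<cdot> p) = e"
    using local_inverse[of "q \<cdot> a \<cdot> p"] a sides by auto
  let ?b = "p \<cdot> n \<cdot> q"
  have "u \<cdot> ?b = p \<cdot> (q \<cdot> p) \<cdot> n \<cdot> q" "?b \<cdot> u = p \<cdot> n \<cdot> (q \<cdot> p) \<cdot> q"
    unfolding pq[symmetric] by (simp_all add: assoc)
  then have b: "u \<cdot> ?b = ?b" "?b \<cdot> u = ?b"
    using sides ne by (simp_all add: qp assoc[of p n e])
  have "u \<cdot> a \<cdot> ?b = p \<cdot> (q \<cdot> a \<cdot> p \<cdot> n) \<cdot> q" "?b \<cdot> (a \<cdot> u) = p \<cdot> (n \<cdot> (q \<cdot> a \<cdot> p)) \<cdot> q"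
    unfolding pq[symmetric] using a by (simp_all add: assoc)
  then have "a \<cdot> ?b = u" "?b \<cdot> a = u"
    using n sides pq by (simp_all add: ua au)
  then show thesis
    using that[of ?b] b by simp
qed

end

end

section \<open>Identities for \<lambda> and \<rho> in an arbitrary left semi-brace\<close>

context left_semi_brace
begin

lemma plus_closed [simp]: "a \<in> carrier B \<Longrightarrow> b \<in> carrier B \<Longrightarrow> a \<boxplus> b \<in> carrier B"
  using plus_semigroup by (auto simp: semigroup_on_def)

lemma plus_assoc:
  "a \<in> carrier B \<Longrightarrow> b \<in> carrier B \<Longrightarrow> c \<in> carrier B \<Longrightarrow> a \<boxplus> b \<boxplus> c = a \<boxplus> (b \<boxplus> c)"
  using plus_semigroup by (auto simp: semigroup_on_def)

lemma plus_one_plus: "b \<in> carrier B \<Longrightarrow> c \<in> carrier B \<Longrightarrow> b \<boxplus> (\<one> \<boxplus> c) = b \<boxplus> c"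
  using left_semi_distrib[of \<one> b c] by simp

lemma lam_closed [simp]: "a \<in> carrier B \<Longrightarrow> b \<in> carrier B \<Longrightarrow> lam B a b \<in> carrier B"
  by (simp add: lam_def)

lemma rho_closed [simp]: "a \<in> carrier B \<Longrightarrow> b \<in> carrier B \<Longrightarrow> rho B b a \<in> carrier B"
  by (simp add: rho_def)

lemma mult_plus:
  "a \<in> carrier B \<Longrightarrow> b \<in> carrier B \<Longrightarrow> c \<in> carrier B \<Longrightarrow> a \<otimes> (b \<boxplus> c) = a \<otimes> b \<boxplus> lam B a c"
  unfolding lam_def by (rule left_semi_distrib)

lemma lam_plus:
  assumes "a \<in> carrier B" "b \<in> carrier B" "c \<in> carrier B"
  shows "lam B a (b \<boxplus> c) = lam B a b \<boxplus> lam B a c"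
proof -
  have "lam B a (b \<boxplus> c) = a \<otimes> (inv a \<boxplus> b \<boxplus> c)"
    using assms by (simp add: lam_def plus_assoc)
  also have "\<dots> = a \<otimes> (inv a \<boxplus> b) \<boxplus> lam B a c"
    using assms by (intro mult_plus) simp_all
  finally show ?thesis
    by (simp add: lam_def[of _ a b])
qed

lemma lam_one_left: "c \<in> carrier B \<Longrightarrow> lam B \<one> c = \<one> \<boxplus> c"
  by (simp add: lam_def)

text \<open>Distributing \<open>b\<close> over \<open>inv (a \<otimes> b) \<boxplus> c\<close>
  yields \<open>inv a \<boxplus> lam B b c\<close>. The resulting action is by additive
  endomorphisms; \<open>\<one>\<close> acts as \<open>c \<mapsto> \<one> \<boxplus> c\<close>, not
  necessarily as the identity.\<close>

lemma lam_mult: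
  assumes "a \<in> carrier B" "b \<in> carrier B" "c \<in> carrier B"
  shows "lam B (a \<otimes> b) c = lam B a (lam B b c)"
proof -
  have "b \<otimes> (inv (a \<otimes> b) \<boxplus> c) = b \<otimes> inv (a \<otimes> b) \<boxplus> lam B b c"
    using assms by (simp add: mult_plus)
  also have "b \<otimes> inv (a \<otimes> b) = inv a"
    using assms by (simp add: inv_mult_group flip: m_assoc)
  finally show ?thesis
    using assms by (simp add: lam_def[of _ a] lam_def[of _ "a \<otimes> b"] m_assoc)
qed

lemma one_plus_lam: "a \<in> carrier B \<Longrightarrow> b \<in> carrier B \<Longrightarrow> \<one> \<boxplus> lam B a b = lam B a b"
  using lam_mult[of \<one> a b] by (simp add: lam_one_left)

lemma plus_lam: "a \<in> carrier B \<Longrightarrow> b \<in> carrier B \<Longrightarrow> a \<boxplus> lam B a b = a \<otimes> (\<one> \<boxplus> b)"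
  by (simp add: mult_plus)

text \<open>Ties the second component of the solution to the first: \<open>sol B\<close> preserves
  products, so \<rho> can be found from \<lambda> by cancellation.\<close>

lemma rho_eq:
  assumes "a \<in> carrier B" "b \<in> carrier B"
  shows "rho B b a = inv (lam B a b) \<otimes> (a \<otimes> b)"
proof -
  have "inv (lam B a b) \<otimes> (a \<otimes> b) = inv (inv a \<boxplus> b) \<otimes> (inv a \<otimes> (a \<otimes> b))"
    using assms by (simp add: lam_def inv_mult_group m_assoc)
  also have "inv a \<otimes> (a \<otimes> b) = b"
    using assms by (simp flip: m_assoc)
  finally show ?thesis
    by (simp add: rho_def)
qed

lemma lam_rho: "a \<in> carrier B \<Longrightarrow> b \<in> carrier B \<Longrightarrow> lam B a b \<otimes> rho B b a = a \<otimes> b"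
  by (simp add: rho_eq flip: m_assoc)

end

section \<open>Consequences of complete simplicity and of the anti-homomorphism property\<close>

locale completely_simple_semi_brace = left_semi_brace +
  assumes completely_simple: "completely_simple_semigroup (carrier B) (plus_op B)"
    and anti_hom: "rho_anti_hom B"
begin

lemma one_plus_one [simp]: "\<one> \<boxplus> \<one> = \<one>"
  and core_inverse:
    "\<lbrakk>a \<in> carrier B; \<one> \<boxplus> a = a; a \<boxplus> \<one> = a\<rbrakk> \<Longrightarrow>
      \<exists>b\<in>carrier B. \<one> \<boxplus> b = b \<and> b \<boxplus> \<one> = b \<and> a \<boxplus> b = \<one> \<and> b \<boxplus> a = \<one>"
proof -
  obtain e where "primitive_idempotent (carrier B) (plus_op B) e"
    and "simple_semigroup (carrier B) (plus_op B)"
    using completely_simple by (auto simp: completely_simple_semigroup_def)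
  then interpret S: primitive_simple_semigroup "carrier B" "plus_op B" e
    by unfold_locales
  show "\<one> \<boxplus> \<one> = \<one>"
    by (rule S.middle_unit_idem) (simp_all add: plus_one_plus)
  assume a: "a \<in> carrier B" "\<one> \<boxplus> a = a" "a \<boxplus> \<one> = a"
  show "\<exists>b\<in>carrier B. \<one> \<boxplus> b = b \<and> b \<boxplus> \<one> = b \<and> a \<boxplus> b = \<one> \<and> b \<boxplus> a = \<one>"
    by (rule S.middle_unit_local_inverse[OF one_closed _ a]) (auto simp add: plus_one_plus)
qed

lemma mem_core: "x \<in> carrier (core B) \<longleftrightarrow> x \<in> carrier B \<and> \<one> \<boxplus> x = x \<and> x \<boxplus> \<one> = x"
  by (auto simp: core_def plus_assoc plus_one_plus intro!: image_eqI[of x _ x])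

lemma core_idempotent:
  assumes "f \<in> carrier (core B)" "f \<boxplus> f = f"
  shows "f = \<one>"
proof -
  obtain b where b: "b \<in> carrier B" "b \<boxplus> f = \<one>"
    using core_inverse assms(1) by (auto simp: mem_core)
  have "b \<boxplus> f \<boxplus> f = b \<boxplus> (f \<boxplus> f)"
    using b assms by (intro plus_assoc) (simp_all add: mem_core)
  then have "\<one> \<boxplus> f = \<one>"
    by (simp only: b assms(2))
  then show ?thesis
    using assms(1) by (metis mem_core)
qed

text \<open>Turns absorption of \<open>\<one>\<close> on the right into a stabiliser condition for
  \<lambda>, which \<open>lam_mult\<close> carries over to products and inverses. The link is
  \<open>a \<boxplus> lam B a \<one> = a\<close>.\<close>

lemma lam_one_right_iff:
  assumes a: "a \<in> carrier B"
  shows "lam B a \<one> = \<one> \<longleftrightarrow> a \<boxplus> \<one> = a"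
proof -
  let ?f = "lam B a \<one>"
  have af: "a \<boxplus> ?f = a"
    using a by (simp add: plus_lam)
  have f: "?f \<in> carrier B" "\<one> \<boxplus> ?f = ?f" "?f \<boxplus> ?f = ?f"
    using a by (simp_all add: one_plus_lam flip: lam_plus)
  have "?f \<boxplus> \<one> \<boxplus> (?f \<boxplus> \<one>) = ?f \<boxplus> (\<one> \<boxplus> (?f \<boxplus> \<one>))"
    using a by (simp add: plus_assoc)
  also have "\<dots> = ?f \<boxplus> (?f \<boxplus> \<one>)"
    using a by (simp add: plus_one_plus)
  also have "\<dots> = ?f \<boxplus> \<one>"
    using f plus_assoc[of ?f ?f \<one>] by simp
  finally have "?f \<boxplus> \<one> \<boxplus> (?f \<boxplus> \<one>) = ?f \<boxplus> \<one>" .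
  moreover have "?f \<boxplus> \<one> \<in> carrier (core B)"
    using f(1,2) by (simp add: mem_core plus_assoc) (simp add: f(1,2) flip: plus_assoc)
  ultimately have f1: "?f \<boxplus> \<one> = \<one>"
    by (intro core_idempotent)
  show ?thesis
  proof
    assume "?f = \<one>"
    with af show "a \<boxplus> \<one> = a" by simp
  next
    assume a1: "a \<boxplus> \<one> = a"
    \<comment> \<open>\<open>\<one> \<boxplus> a\<close> lies in the core, and its additive inverse
      cancels \<open>a\<close> in \<open>a \<boxplus> ?f = a\<close>.\<close>
    have "\<one> \<boxplus> (\<one> \<boxplus> a) = \<one> \<boxplus> a" "\<one> \<boxplus> a \<boxplus> \<one> = \<one> \<boxplus> a"
      using a a1 by (simp_all add: plus_one_plus plus_assoc)
    then obtain b where b: "b \<in> carrier B" "b \<boxplus> (\<one> \<boxplus> a) = \<one>"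
      using core_inverse[of "\<one> \<boxplus> a"] a by auto
    then have ba: "b \<boxplus> a = \<one>"
      using a by (simp add: plus_one_plus)
    have "b \<boxplus> a \<boxplus> ?f = b \<boxplus> a"
      using a b f af by (simp add: plus_assoc)
    with ba f(2) show "?f = \<one>" by simp
  qed
qed

text \<open>Additive form of the anti-homomorphism property: expanding
  \<open>rho B (b \<otimes> c)\<close> at \<open>inv x\<close> gives \<open>x \<boxplus> b \<otimes>
  c = x \<boxplus> b \<boxplus> lam B b c\<close>, whose last two summands add up to
  \<open>b \<otimes> (\<one> \<boxplus> c)\<close>.\<close>

lemma plus_mult:
  assumes "x \<in> carrier B" "b \<in> carrier B" "c \<in> carrier B"
  shows "x \<boxplus> b \<otimes> (\<one> \<boxplus> c) = x \<boxplus> b \<otimes> c"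
proof -
  have "rho B (b \<otimes> c) (inv x) = rho B c (rho B b (inv x))"
    using anti_hom assms by (simp add: rho_anti_hom_def)
  then have "inv (x \<boxplus> b \<otimes> c) \<otimes> b \<otimes> c = inv (inv (rho B b (inv x)) \<boxplus> c) \<otimes> c"
    using assms by (simp add: rho_def[of _ "b \<otimes> c"] rho_def[of _ c] m_assoc)
  then have "inv (inv (x \<boxplus> b \<otimes> c) \<otimes> b) = inv (rho B b (inv x)) \<boxplus> c"
    using assms by simp
  then have "inv b \<otimes> (x \<boxplus> b \<otimes> c) = inv b \<otimes> (x \<boxplus> b) \<boxplus> c"
    using assms by (simp add: inv_mult_group rho_def)
  moreover have cancel: "b \<otimes> (inv b \<otimes> y) = y" if "y \<in> carrier B" for y
    using assms that by (simp flip: m_assoc)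
  ultimately have "x \<boxplus> b \<otimes> c = b \<otimes> (inv b \<otimes> (x \<boxplus> b) \<boxplus> c)"
    using assms cancel[of "x \<boxplus> b \<otimes> c"] by simp
  also have "\<dots> = x \<boxplus> b \<boxplus> lam B b c"
    using assms mult_plus[of b "inv b \<otimes> (x \<boxplus> b)" c] cancel by simp
  finally show ?thesis
    using assms by (simp add: plus_assoc flip: plus_lam)
qed

text \<open>The anti-homomorphism property at \<open>b \<otimes> \<one>\<close> shows that
  \<open>rho B \<one>\<close> fixes \<open>v = rho B b a\<close>, so \<open>inv v\<close> absorbs
  \<open>\<one>\<close> on the right. The stabiliser condition passes this on to
  \<open>v\<close>.\<close>

lemma rho_plus_one:
  assumes "a \<in> carrier B" "b \<in> carrier B"
  shows "rho B b a \<boxplus> \<one> = rho B b a"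
proof -
  let ?v = "rho B b a"
  have "rho B \<one> ?v = rho B (b \<otimes> \<one>) a"
    using anti_hom assms one_closed unfolding rho_anti_hom_def by metis
  also have "\<dots> = ?v"
    using assms by simp
  finally have "inv (inv ?v \<boxplus> \<one>) = ?v"
    using assms by (simp add: rho_def[of _ \<one>])
  then have "inv (inv (inv ?v \<boxplus> \<one>)) = inv ?v"
    by (simp only:)
  then have "inv ?v \<boxplus> \<one> = inv ?v"
    using assms by simp
  then have "lam B (inv ?v) \<one> = \<one>"
    using assms by (simp add: lam_one_right_iff)
  moreover have "lam B ?v (lam B (inv ?v) \<one>) = \<one>"
    using assms by (simp add: lam_one_left flip: lam_mult)
  ultimately show ?thesis
    using assms by (simp flip: lam_one_right_iff)
qed

section \<open>The skew left brace formed by the core\<close>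

lemma one_plus_mult:
  "a \<in> carrier B \<Longrightarrow> b \<in> carrier B \<Longrightarrow> \<one> \<boxplus> a = a \<Longrightarrow> \<one> \<boxplus> b = b \<Longrightarrow> \<one> \<boxplus> a \<otimes> b = a \<otimes> b"
  using plus_lam[of a b] plus_assoc[of \<one> a "lam B a b"] by simp

text \<open>The element \<open>a \<otimes> (\<one> \<boxplus> inv a)\<close> absorbs
  \<open>\<one>\<close> on the left, while \<open>plus_mult\<close> evaluates its sum with
  \<open>\<one>\<close> to \<open>\<one>\<close>. Hence \<open>\<one> \<boxplus> inv a\<close> is
  inverse to \<open>a\<close>.\<close>

lemma one_plus_inv:
  assumes a: "a \<in> carrier B" "\<one> \<boxplus> a = a"
  shows "\<one> \<boxplus> inv a = inv a"
proof -
  have "\<one> \<boxplus> a \<otimes> (\<one> \<boxplus> inv a) = \<one>"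
    using a by (simp add: plus_mult)
  moreover have "\<one> \<boxplus> a \<otimes> (\<one> \<boxplus> inv a) = a \<otimes> (\<one> \<boxplus> inv a)"
    using a by (intro one_plus_mult) (simp_all add: plus_one_plus)
  ultimately show ?thesis
    using a by (metis inv_closed inv_equality inv_inv one_closed plus_closed)
qed

lemma core_subgroup: "subgroup (carrier (core B)) B"
proof
  show "carrier (core B) \<subseteq> carrier B" "\<one> \<in> carrier (core B)"
    by (auto simp: mem_core)
next
  fix x y assume "x \<in> carrier (core B)" "y \<in> carrier (core B)"
  then show "x \<otimes> y \<in> carrier (core B)"
    by (auto simp: mem_core one_plus_mult lam_mult simp flip: lam_one_right_iff)
next
  fix x assume x: "x \<in> carrier (core B)"
  then have "lam B (inv x) (lam B x \<one>) = \<one>" "lam B x \<one> = \<one>"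
    by (simp_all add: mem_core lam_one_left lam_one_right_iff flip: lam_mult)
  then have "lam B (inv x) \<one> = \<one>"
    by simp
  then show "inv x \<in> carrier (core B)"
    using x by (simp add: mem_core one_plus_inv flip: lam_one_right_iff)
qed

lemma core_simps [simp]:
  "mult (core B) = mult B" "plus_op (core B) = plus_op B" "one (core B) = \<one>"
  by (simp_all add: core_def)

lemma core_inv: "x \<in> carrier (core B) \<Longrightarrow> inv\<^bsub>core B\<^esub> x = inv x"
  using m_inv_consistent[OF core_subgroup] by (simp add: core_def)

lemma core_group: "group (core B)"
  using subgroup.subgroup_is_group[OF core_subgroup is_group] by (simp add: core_def)

lemma core_mult [simp]:
  "x \<in> carrier (core B) \<Longrightarrow> y \<in> carrier (core B) \<Longrightarrow> x \<otimes> y \<in> carrier (core B)"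
  using core_subgroup by (rule subgroup.m_closed)

lemma core_inv_closed [simp]: "x \<in> carrier (core B) \<Longrightarrow> inv x \<in> carrier (core B)"
  using core_subgroup by (rule subgroup.m_inv_closed)

lemma core_plus [simp]:
  assumes "x \<in> carrier (core B)" "y \<in> carrier (core B)"
  shows "x \<boxplus> y \<in> carrier (core B)"
  using assms plus_assoc[of \<one> x y] by (simp add: mem_core plus_assoc)

lemma core_carrier: "x \<in> carrier (core B) \<Longrightarrow> x \<in> carrier B"
  by (simp add: mem_core)

lemma core_lam [simp]:
  "x \<in> carrier (core B) \<Longrightarrow> y \<in> carrier (core B) \<Longrightarrow> lam B x y \<in> carrier (core B)"
  by (simp add: lam_def)

lemma core_rho [simp]:
  "x \<in> carrier (core B) \<Longrightarrow> y \<in> carrier (core B) \<Longrightarrow> rho B y x \<in> carrier (core B)"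
  by (simp add: rho_def)

lemma sol_core:
  "x \<in> carrier (core B) \<Longrightarrow> y \<in> carrier (core B) \<Longrightarrow> sol (core B) (x, y) = (lam B x y, rho B y x)"
  by (simp add: sol_def lam_def rho_def core_inv)

lemma core_plus_lam:
  "x \<in> carrier (core B) \<Longrightarrow> y \<in> carrier (core B) \<Longrightarrow> x \<boxplus> lam B x y = x \<otimes> y"
  by (simp add: plus_lam mem_core)

lemma core_additive_group: "group (additive (core B) \<one>)"
proof (rule groupI)
  fix x assume "x \<in> carrier (additive (core B) \<one>)"
  then show "\<exists>y\<in>carrier (additive (core B) \<one>).
      y \<otimes>\<^bsub>additive (core B) \<one>\<^esub> x = \<one>\<^bsub>additive (core B) \<one>\<^esub>"
    using core_inverse[of x] by (auto simp: additive_def mem_core)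
qed (simp_all add: additive_def mem_core plus_assoc, simp flip: plus_assoc)

text \<open>In the additive group of the core, \<open>a \<boxplus> lam B a c = a \<otimes> c\<close>
  can be solved for \<open>lam B a c\<close>; substitution in \<open>mult_plus\<close> gives the
  skew brace law.\<close>

lemma core_skew_left_brace: "skew_left_brace (core B)"
  unfolding skew_left_brace_def
proof (intro conjI exI[of _ \<one>] ballI)
  fix a b c assume abc: "a \<in> carrier (core B)" "b \<in> carrier (core B)" "c \<in> carrier (core B)"
  interpret A: group "additive (core B) \<one>"
    by (rule core_additive_group)
  let ?i = "inv\<^bsub>additive (core B) \<one>\<^esub> a"
  have i: "?i \<in> carrier (core B)" "?i \<boxplus> a = \<one>"
    using A.inv_closed[of a] A.l_inv[of a] abc by (simp_all add: additive_def)
  have "?i \<boxplus> a \<otimes> c = ?i \<boxplus> a \<boxplus> lam B a c"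
    using abc i(1) by (simp add: plus_assoc core_carrier core_plus_lam)
  also have "\<dots> = lam B a c"
    using abc by (simp add: i one_plus_lam core_carrier)
  finally have lam: "lam B a c = ?i \<boxplus> a \<otimes> c" ..
  show "a \<otimes>\<^bsub>core B\<^esub> (b \<boxplus>\<^bsub>core B\<^esub> c) =
      a \<otimes>\<^bsub>core B\<^esub> b \<boxplus>\<^bsub>core B\<^esub> ?i \<boxplus>\<^bsub>core B\<^esub> a \<otimes>\<^bsub>core B\<^esub> c"
    using abc i(1) by (simp add: plus_assoc mult_plus lam core_carrier)
qed (rule core_group core_additive_group)+

section \<open>The solution of the core, and the solution of \<open>B\<close> in terms of it\<close>

lemma core_plus_cancel:
  assumes "x \<in> carrier (core B)" "y \<in> carrier (core B)" "z \<in> carrier (core B)"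
  shows "x \<boxplus> z = y \<boxplus> z \<longleftrightarrow> x = y" and "z \<boxplus> x = z \<boxplus> y \<longleftrightarrow> x = y"
proof -
  interpret A: group "additive (core B) \<one>"
    by (rule core_additive_group)
  show "x \<boxplus> z = y \<boxplus> z \<longleftrightarrow> x = y" "z \<boxplus> x = z \<boxplus> y \<longleftrightarrow> x = y"
    using A.right_cancel[of z x y, unfolded additive_def]
      A.Units_l_cancel[of z x y, unfolded A.Units_eq, unfolded additive_def] assms
    by simp_all
qed

lemma sol_core_inj:
  assumes x: "x \<in> carrier (core B) \<times> carrier (core B)"
    and y: "y \<in> carrier (core B) \<times> carrier (core B)"
    and eq: "sol (core B) x = sol (core B) y"
  shows "x = y"
proof -
  obtain a b c d where xy: "x = (a, b)" "y = (c, d)"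
    by (metis surj_pair)
  have G: "a \<in> carrier (core B)" "b \<in> carrier (core B)" "c \<in> carrier (core B)" "d \<in> carrier (core B)"
    using x y xy by auto
  have l: "lam B a b = lam B c d" and r: "rho B b a = rho B d c"
    using eq G by (simp_all add: xy sol_core)
  have ab: "a \<otimes> b = c \<otimes> d"
    using G l r by (metis lam_rho core_carrier)
  then have "a \<boxplus> lam B a b = c \<boxplus> lam B a b"
    using G by (metis core_plus_lam l)
  then have "a = c"
    using G by (simp add: core_plus_cancel)
  with ab G show ?thesis
    by (simp add: xy core_carrier)
qed

text \<open>By \<open>plus_mult\<close> and \<open>\<one> \<boxplus> k = \<one>\<close>, the factor
  \<open>k\<close> does not affect \<open>lam B h\<close>. Since
  \<open>inv e \<boxplus> lam B h g = lam B h g\<close>, the map \<open>lam B e\<close> acts on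
  \<open>lam B h g\<close> as left multiplication by \<open>e\<close>. Preservation of products
  gives the second component.\<close>

lemma sol_factor:
  assumes e: "e \<in> carrier B" "inv e \<boxplus> \<one> = \<one>" and k: "k \<in> carrier B" "\<one> \<boxplus> k = \<one>"
    and G: "h \<in> carrier (core B)" "g \<in> carrier (core B)"
  shows "sol B (e \<otimes> h, g \<otimes> k) = (e \<otimes> lam B h g, rho B g h \<otimes> k)"
proof -
  note G' = G[THEN core_carrier]
  have h: "lam B h (g \<otimes> k) = lam B h g"
    using G' k plus_mult[of "inv h" g k] by (simp add: lam_def)
  have "inv e \<boxplus> lam B h g = inv e \<boxplus> \<one> \<boxplus> lam B h g"
    using e(1) G' by (simp add: plus_assoc plus_one_plus)
  then have "lam B e (lam B h g) = e \<otimes> lam B h g"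
    using e G' by (simp add: lam_def[of _ e] one_plus_lam)
  then have l: "lam B (e \<otimes> h) (g \<otimes> k) = e \<otimes> lam B h g"
    using e k G' by (simp add: lam_mult h)
  have "e \<otimes> lam B h g \<otimes> (rho B g h \<otimes> k) = e \<otimes> (lam B h g \<otimes> rho B g h) \<otimes> k"
    using e k G' by (simp add: m_assoc)
  also have "\<dots> = e \<otimes> h \<otimes> (g \<otimes> k)"
    using e k G' by (simp add: lam_rho m_assoc)
  also have "\<dots> = e \<otimes> lam B h g \<otimes> rho B (g \<otimes> k) (e \<otimes> h)"
    using e k G' lam_rho[of "e \<otimes> h" "g \<otimes> k"] by (simp add: l)
  finally have "rho B (g \<otimes> k) (e \<otimes> h) = rho B g h \<otimes> k"
    using e k G' by simp
  with l show ?thesis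
    by (simp add: sol_def)
qed

lemma sol_core_pow_closed:
  assumes "x \<in> carrier (core B) \<times> carrier (core B)"
  shows "(sol (core B) ^^ n) x \<in> carrier (core B) \<times> carrier (core B)"
proof (induction n)
  case (Suc n)
  then show ?case
    by (cases "(sol (core B) ^^ n) x") (simp add: sol_core)
qed (use assms in simp)

lemma sol_factor_pow:
  assumes e: "e \<in> carrier B" "inv e \<boxplus> \<one> = \<one>" and k: "k \<in> carrier B" "\<one> \<boxplus> k = \<one>"
    and G: "h \<in> carrier (core B)" "g \<in> carrier (core B)"
  shows "(sol B ^^ n) (e \<otimes> h, g \<otimes> k) =
    map_prod (\<lambda>x. e \<otimes> x) (\<lambda>y. y \<otimes> k) ((sol (core B) ^^ n) (h, g))"
proof (induction n)
  case (Suc n)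
  obtain x y where xy: "(sol (core B) ^^ n) (h, g) = (x, y)"
    by fastforce
  then have "x \<in> carrier (core B)" "y \<in> carrier (core B)"
    using sol_core_pow_closed[of "(h, g)" n] G by auto
  then show ?case
    by (simp add: Suc xy sol_factor[OF e k] sol_core)
qed simp

lemma sol_image_factor:
  assumes a: "a \<in> carrier B" and b: "b \<in> carrier B"
  obtains e h g k where "sol B (a, b) = (e \<otimes> h, g \<otimes> k)"
    "e \<in> carrier B" "inv e \<boxplus> \<one> = \<one>" "k \<in> carrier B" "\<one> \<boxplus> k = \<one>"
    "h \<in> carrier (core B)" "g \<in> carrier (core B)"
proof -
  define u v where "u = lam B a b" and "v = rho B b a"
  have u: "u \<in> carrier B" "\<one> \<boxplus> u = u" and v: "v \<in> carrier B" "v \<boxplus> \<one> = v"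
    using a b by (simp_all add: u_def v_def one_plus_lam rho_plus_one)
  \<comment> \<open>\<open>inv h\<close> and \<open>g\<close> are the projections
    \<open>\<one> \<boxplus> _ \<boxplus> \<one>\<close> of \<open>inv u\<close> and
    \<open>v\<close>; what remains of \<open>u\<close> and \<open>v\<close> becomes \<open>e\<close>
    and \<open>k\<close>.\<close>
  define h g where "h = inv (inv u \<boxplus> \<one>)" and "g = \<one> \<boxplus> v"
  have "inv u \<boxplus> \<one> \<in> carrier (core B)"
    using u one_plus_inv[OF u] by (simp add: mem_core plus_assoc) (simp flip: plus_assoc)
  then have h: "h \<in> carrier (core B)"
    by (simp add: h_def)
  have g: "g \<in> carrier (core B)"
    using v by (simp add: g_def mem_core plus_assoc plus_one_plus)
  note [simp] = h[THEN core_carrier] g[THEN core_carrier]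
  show thesis
  proof (rule that[of "u \<otimes> inv h" h g "inv g \<otimes> v"])
    show "sol B (a, b) = (u \<otimes> inv h \<otimes> h, g \<otimes> (inv g \<otimes> v))"
      using u v by (simp add: sol_def m_assoc u_def v_def) (simp add: a b flip: m_assoc)
    \<comment> \<open>\<open>h\<close> stabilises \<open>\<one>\<close>, and writing
      \<open>\<one>\<close> as \<open>lam B h \<one>\<close> makes \<open>mult_plus\<close>
      applicable.\<close>
    have "h \<otimes> inv u \<boxplus> \<one> = h \<otimes> inv u \<boxplus> lam B h \<one>"
      using h lam_one_right_iff[of h] by (simp add: mem_core)
    also have "\<dots> = h \<otimes> (inv u \<boxplus> \<one>)"
      using u by (simp add: mult_plus)
    also have "\<dots> = \<one>"
      using u by (simp add: h_def)
    finally show "inv (u \<otimes> inv h) \<boxplus> \<one> = \<one>"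
      using u by (simp add: inv_mult_group)
    have "\<one> \<boxplus> inv g \<otimes> v = \<one> \<boxplus> inv g \<otimes> g"
      using v plus_mult[of \<one> "inv g" v] by (simp add: g_def[symmetric])
    then show "\<one> \<boxplus> inv g \<otimes> v = \<one>"
      by simp
  qed (use u v h g in simp_all)
qed

text \<open>After one application of \<open>sol B\<close>, the iterates act through
  \<open>sol (core B)\<close> on the coordinates \<open>(h, g)\<close>. Conversely,
  \<open>sol B\<close> restricts to \<open>sol (core B)\<close> on the core, where injectivity
  cancels the surplus application.\<close>

lemma sol_pow_iff:
  "(\<forall>x \<in> carrier (core B) \<times> carrier (core B). (sol (core B) ^^ n) x = x) \<longleftrightarrow>
   (\<forall>x \<in> carrier B \<times> carrier B. (sol B ^^ (n + 1)) x = sol B x)"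
  (is "?l \<longleftrightarrow> ?r")
proof
  assume l: ?l
  show ?r
  proof clarify
    fix a b assume "a \<in> carrier B" "b \<in> carrier B"
    then obtain e h g k where *: "sol B (a, b) = (e \<otimes> h, g \<otimes> k)"
      and F: "e \<in> carrier B" "inv e \<boxplus> \<one> = \<one>" "k \<in> carrier B" "\<one> \<boxplus> k = \<one>"
        "h \<in> carrier (core B)" "g \<in> carrier (core B)"
      using sol_image_factor by metis
    have "(sol (core B) ^^ n) (h, g) = (h, g)"
      using l F by blast
    then show "(sol B ^^ (n + 1)) (a, b) = sol B (a, b)"
      by (simp add: funpow_swap1 * sol_factor_pow[OF F])
  qed
next
  assume r: ?r
  have restrict: "(sol B ^^ m) (h, g) = (sol (core B) ^^ m) (h, g)"
    if G: "h \<in> carrier (core B)" "g \<in> carrier (core B)" for h g m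
  proof -
    obtain x y where xy: "(sol (core B) ^^ m) (h, g) = (x, y)"
      by fastforce
    then have "x \<in> carrier B" "y \<in> carrier B"
      using sol_core_pow_closed[of "(h, g)" m] G by (auto simp: core_carrier)
    then show ?thesis
      using sol_factor_pow[of \<one> \<one> h g m] G by (simp add: xy core_carrier)
  qed
  show ?l
  proof clarify
    fix h g assume G: "h \<in> carrier (core B)" "g \<in> carrier (core B)"
    \<comment> \<open>The right side is a first power so that \<open>restrict\<close> rewrites both
      sides.\<close>
    have "(sol B ^^ (n + 1)) (h, g) = (sol B ^^ 1) (h, g)"
      using r G by (simp add: core_carrier)
    then have eq: "sol (core B) ((sol (core B) ^^ n) (h, g)) = sol (core B) (h, g)"
      unfolding restrict[OF G] by simp
    have "(h, g) \<in> carrier (core B) \<times> carrier (core B)"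
      using G by simp
    then show "(sol (core B) ^^ n) (h, g) = (h, g)"
      by (intro sol_core_inj[OF _ _ eq] sol_core_pow_closed)
  qed
qed

section \<open>Involutivity and commutativity of the addition\<close>

lemma lam_commute_iff_sol_involutive:
  assumes G: "a \<in> carrier (core B)" "b \<in> carrier (core B)"
  shows "(sol (core B) ^^ 2) (a, b) = (a, b) \<longleftrightarrow> a \<boxplus> lam B a b = lam B a b \<boxplus> a"
proof -
  define u v where "u = lam B a b" and "v = rho B b a"
  have uv: "u \<in> carrier (core B)" "v \<in> carrier (core B)"
    using G by (simp_all add: u_def v_def)
  have ab: "u \<otimes> v = a \<otimes> b"
    using G by (simp add: u_def v_def lam_rho core_carrier)
  have "(sol (core B) ^^ 2) (a, b) = (lam B u v, rho B v u)"
    using G uv by (simp add: numeral_2_eq_2 sol_core u_def v_def)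
  \<comment> \<open>The product \<open>a \<otimes> b\<close> is preserved, so the first entry
    determines the second.\<close>
  moreover have "rho B v u = b" if "lam B u v = a"
    using G uv that lam_rho[of u v] by (simp add: ab core_carrier)
  moreover have "lam B u v = a \<longleftrightarrow> a \<boxplus> u = u \<boxplus> a"
  proof -
    have "lam B u v = a \<longleftrightarrow> u \<boxplus> lam B u v = u \<boxplus> a"
      using G uv by (simp add: core_plus_cancel)
    also have "u \<boxplus> lam B u v = a \<boxplus> u"
      using G uv by (simp add: core_plus_lam ab u_def[symmetric]) (simp add: u_def core_plus_lam)
    finally show ?thesis .
  qed
  ultimately show ?thesis
    by (auto simp: u_def)
qed

lemma left_brace_iff:
  "left_brace (core B) \<longleftrightarrow>
    (\<forall>x \<in> carrier (core B) \<times> carrier (core B). (sol (core B) ^^ 2) x = x)"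
proof
  assume "left_brace (core B)"
  then show "\<forall>x \<in> carrier (core B) \<times> carrier (core B). (sol (core B) ^^ 2) x = x"
    by (auto simp: left_brace_def lam_commute_iff_sol_involutive)
next
  assume inv: "\<forall>x \<in> carrier (core B) \<times> carrier (core B). (sol (core B) ^^ 2) x = x"
  have "a \<boxplus> c = c \<boxplus> a" if G: "a \<in> carrier (core B)" "c \<in> carrier (core B)" for a c
  proof -
    \<comment> \<open>Every \<open>c\<close> in the core is some \<open>lam B a b\<close>, so
      commuting with these values is commuting with everything.\<close>
    have "lam B a (lam B (inv a) c) = c"
      using G by (simp add: core_carrier lam_one_left flip: lam_mult) (simp add: mem_core)
    then show ?thesis
      using inv G lam_commute_iff_sol_involutive[of a "lam B (inv a) c"] by auto
  qed
  then show "left_brace (core B)"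
    by (simp add: left_brace_def core_skew_left_brace)
qed

end

theorem corollary12:
  fixes B :: "('a, 'm) semi_brace_scheme" and G :: "('a, 'm) semi_brace_scheme"
  defines "G \<equiv> core B"
  assumes "left_semi_brace B"
    and "completely_simple_semigroup (carrier B) (plus_op B)"
    and "rho_anti_hom B"
  shows "(\<forall>n\<ge>1.
            (\<forall>x \<in> carrier G \<times> carrier G. (sol G ^^ n) x = x) \<longleftrightarrow>
            (\<forall>x \<in> carrier B \<times> carrier B. (sol B ^^ (n + 1)) x = sol B x))
       \<and> (left_brace G \<longleftrightarrow> (\<forall>x \<in> carrier B \<times> carrier B. (sol B ^^ 3) x = sol B x))"
proof -
  interpret completely_simple_semi_brace B
    using assms(2-4)
    by (simp add: completely_simple_semi_brace_def completely_simple_semi_brace_axioms_def)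
  \<comment> \<open>Involutivity is the case \<open>n = 2\<close>, whence the exponent 3.\<close>
  show ?thesis
    unfolding G_def left_brace_iff using sol_pow_iff sol_pow_iff[of 2] by simp
qed

end
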